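(* Let $T>0$, $d\ge 1$, $X\in C^2([0,T]^2;\mathbb{R}^d)$, and let $\mathbf{S}(X)$ be its full 2D signature. Let $(w,\nu)\in\hat{\mathcal W}_n$ and $(w',\nu')\in\hat{\mathcal W}_{n'}$ be two extended words. Then for all $\mathbf{s}=(s_1,s_2),\mathbf{t}=(t_1,t_2)\in[0,T]^2$ with $s_1\le t_1$ and $s_2\le t_2$, $$\langle \mathbf{S}_{\mathbf{s}\mathbf{t}}(X),(w,\nu)\rangle\,\langle \mathbf{S}_{\mathbf{s}\mathbf{t}}(X),(w',\nu')\rangle=\sum_{\tau\in \mathrm{Sh}(\mathrm{id}_n,\mathrm{id}_{n'})}\ \sum_{\lambda\in \mathrm{Sh}(\nu,\nu')}\langle \mathbf{S}_{\mathbf{s}\mathbf{t}}(X),([ww']_\tau,\lambda\circ\tau)\rangle .$$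
   Context: Words: $\mathcal W_n$ is the set of words $w=(w_1,\dots,w_n)$ with letters in $\{1,\dots,d\}$. $\Sigma_n$ is the group of permutations of $\{1,\dots,n\}$; $\mathrm{id}_n$ is its identity. Extended words: $\hat{\mathcal W}_n=\{(w,\nu): w\in\mathcal W_n,\ \nu\in\Sigma_n\}$. $[ww']$ is the concatenation of $w$ and $w'$. For a word $w$ of length $m$ and $\tau\in\Sigma_m$, $w_\tau=(w_{\tau(1)},\dots,w_{\tau(m)})$. Full 2D signature: for $\mathbf s,\mathbf t\in[0,T]^2$ with $s_1\le t_1$, $s_2\le t_2$ let $$\Delta^n_{[\mathbf s,\mathbf t]}=\{(\mathbf r^1,\dots,\mathbf r^n)\in([0,T]^2)^n:\ s_1\le r_1^1\le\dots\le r_1^n\le t_1,\ s_2\le r_2^1\le\dots\le r_2^n\le t_2\},\quad \mathbf r^i=(r^i_1,r^i_2).$$ With $\partial_{12}X=\frac{\partial^2X}{\partial r_1\partial r_2}$, for $(w,\nu)\in\hat{\mathcal W}_n$ set $$\langle \mathbf S_{\mathbf s\mathbf t}(X),(w,\nu)\rangle=\int_{\Delta^n_{[\mathbf s,\mathbf t]}}\prod_{i=1}^n\partial_{12}X^{w_i}(r_1^i,r_2^{\nu(i)})\,d\mathbf r^1\cdots d\mathbf r^n$$ (Lebesgue measure on $\mathbb R^{2n}$; the value is $1$ for the empty word). Shuffles: $\mathrm{sh}(n,k)$ is the set of $\rho\in\Sigma_{n+k}$ with $\rho(i)<\rho(j)$ whenever $1\le i<j\le n$ or $n+1\le i<j\le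 n+k$. For $\sigma\in\Sigma_n$, $\tau\in\Sigma_k$, let $\sigma*\tau\in\Sigma_{n+k}$ be given by $(\sigma*\tau)(i)=\sigma(i)$ for $i\le n$ and $(\sigma*\tau)(i)=\tau(i-n)+n$ for $i\ge n+1$. Then $$\mathrm{Sh}(\sigma,\tau)=\{(\sigma*\tau)\circ\rho^{-1}:\ \rho\in\mathrm{sh}(n,k)\}.$$
   Formalization: The printed formula fails (e.g. w=(1,1), w'=(2), identity permutations, ∂₁₂X¹=1, ∂₁₂X²=r₂ on the unit square: 1/8 against 7/48); the inner sum is corrected to run over λ in Sh(ν⁻¹,ν'⁻¹) with λ⁻¹∘τ in place of λ∘τ. *)

theory Defs
  imports "HOL-Analysis.Analysis" "HOL-Combinatorics.Combinatorics"
begin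

section \<open>Twice continuously differentiable fields on a closed square\<close>

text \<open>At the edges of \<open>[0,T]\<^sup>2\<close> the partial derivatives are one-sided, since they are taken
  within \<open>[0,T]\<close>.\<close>

definition square :: "real \<Rightarrow> (real \<times> real) set" where
  "square T = {0..T} \<times> {0..T}"

definition partial1 :: "real \<Rightarrow> (real \<times> real \<Rightarrow> 'a::real_normed_vector) \<Rightarrow> real \<times> real \<Rightarrow> 'a" where
  "partial1 T F r = vector_derivative (\<lambda>x. F (x, snd r)) (at (fst r) within {0..T})"

definition partial2 :: "real \<Rightarrow> (real \<times> real \<Rightarrow> 'a::real_normed_vector) \<Rightarrow> real \<times> real \<Rightarrow> 'a" where
  "partial2 T F r = vector_derivative (\<lambda>y. F (fst r, y)) (at (snd r) within {0..T})"

primrec Ck_on_square :: "nat \<Rightarrow> real \<Rightarrow> (real \<times> real \<Rightarrow> 'a::real_normed_vector) \<Rightarrow> bool" where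
  "Ck_on_square 0 T F \<longleftrightarrow> continuous_on (square T) F"
| "Ck_on_square (Suc k) T F \<longleftrightarrow>
     continuous_on (square T) F \<and>
     (\<forall>r \<in> square T.
        (\<lambda>x. F (x, snd r)) differentiable (at (fst r) within {0..T}) \<and>
        (\<lambda>y. F (fst r, y)) differentiable (at (snd r) within {0..T})) \<and>
     Ck_on_square k T (partial1 T F) \<and> Ck_on_square k T (partial2 T F)"

definition partial12 :: "real \<Rightarrow> (real \<times> real \<Rightarrow> 'a::real_normed_vector) \<Rightarrow> real \<times> real \<Rightarrow> 'a" where
  "partial12 T F = partial1 T (partial2 T F)"


section \<open>Extended words and the full 2D signature\<close>

text \<open>Positions are counted from 0: \<open>\<Sigma>\<^sub>n\<close> is the set of permutations of \<open>{..<n}\<close>, and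
  \<open>permute_list \<tau> w\<close> is \<open>w\<^sub>\<tau>\<close>. The alphabet \<open>{1,...,d}\<close> is the finite index type \<open>'d\<close>.\<close>

definition ext_words :: "nat \<Rightarrow> ('d list \<times> (nat \<Rightarrow> nat)) set" where
  "ext_words n = {(w, \<nu>). length w = n \<and> \<nu> permutes {..<n}}"

definition Delta :: "nat \<Rightarrow> real \<times> real \<Rightarrow> real \<times> real \<Rightarrow> (nat \<Rightarrow> real \<times> real) set" where
  "Delta n s t =
     {r \<in> {..<n} \<rightarrow>\<^sub>E {fst s..fst t} \<times> {snd s..snd t}.
        mono_on {..<n} (\<lambda>i. fst (r i)) \<and> mono_on {..<n} (\<lambda>i. snd (r i))}"

definition sig2 ::
  "real \<Rightarrow> (real \<times> real \<Rightarrow> real ^ 'd) \<Rightarrow> real \<times> real \<Rightarrow> real \<times> real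
    \<Rightarrow> 'd list \<times> (nat \<Rightarrow> nat) \<Rightarrow> real" where
  "sig2 T X s t = (\<lambda>(w, \<nu>).
     set_lebesgue_integral (Pi\<^sub>M {..<length w} (\<lambda>_. lborel)) (Delta (length w) s t)
       (\<lambda>r. \<Prod>i<length w. partial12 T X (fst (r i), snd (r (\<nu> i))) $ (w ! i)))"


section \<open>Shuffles\<close>

definition sh :: "nat \<Rightarrow> nat \<Rightarrow> (nat \<Rightarrow> nat) set" where
  "sh n k = {\<rho>. \<rho> permutes {..<n + k} \<and> strict_mono_on {..<n} \<rho> \<and> strict_mono_on {n..<n + k} \<rho>}"

definition perm_concat :: "nat \<Rightarrow> (nat \<Rightarrow> nat) \<Rightarrow> (nat \<Rightarrow> nat) \<Rightarrow> nat \<Rightarrow> nat" where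
  "perm_concat n \<sigma> \<tau> i = (if i < n then \<sigma> i else \<tau> (i - n) + n)"

text \<open>For \<open>\<sigma> \<in> \<Sigma>\<^sub>n\<close> and \<open>\<tau> \<in> \<Sigma>\<^sub>k\<close>. A pitfall when these sets are used in the product formula of the
  signature: there, merging the first coordinates by \<open>\<rho>\<^sub>1\<close> and the second ones by \<open>\<rho>\<^sub>2\<close> turns the
  pairing \<open>\<nu> * \<nu>'\<close> (that is, \<open>perm_concat n \<nu> \<nu>'\<close>) into \<open>\<rho>\<^sub>2 \<circ> (\<nu> * \<nu>') \<circ> inv \<rho>\<^sub>1\<close>. The left part
  \<open>\<rho>\<^sub>2 \<circ> (\<nu> * \<nu>')\<close> is in general not in \<open>Sh n k \<nu> \<nu>'\<close>; it is \<open>inv \<mu>\<close> for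
  \<open>\<mu> = (inv \<nu> * inv \<nu>') \<circ> inv \<rho>\<^sub>2\<close> in \<open>Sh n k (inv \<nu>) (inv \<nu>')\<close>. The formula with \<open>\<mu> \<circ> \<tau>\<close> for
  \<open>\<mu> \<in> Sh n k \<nu> \<nu>'\<close> fails already for \<open>n = 2\<close>, \<open>k = 1\<close> and identity permutations.\<close>

definition Sh :: "nat \<Rightarrow> nat \<Rightarrow> (nat \<Rightarrow> nat) \<Rightarrow> (nat \<Rightarrow> nat) \<Rightarrow> (nat \<Rightarrow> nat) set" where
  "Sh n k \<sigma> \<tau> = (\<lambda>\<rho>. perm_concat n \<sigma> \<tau> \<circ> inv \<rho>) ` sh n k"

end

theory Submission
  imports Defs
begin

text \<open>By Fubini the product of the two signatures is one integral over \<open>n + n'\<close> points of the plane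
  whose first \<open>n\<close> and last \<open>n'\<close> points are each increasing in both coordinates. Outside a null set
  all first coordinates are distinct, and so are all second coordinates; then exactly one shuffle
  \<open>\<alpha>\<close> sorts the first coordinates and exactly one shuffle \<open>\<beta>\<close> sorts the second ones, so the domain
  splits into one piece for each pair \<open>(\<alpha>, \<beta>)\<close>. Lebesgue measure is invariant under permuting the
  first coordinates and the second coordinates separately, and this change of variables carries the
  piece of \<open>(\<alpha>, \<beta>)\<close> to the simplex and the pairing \<open>\<nu> * \<nu>'\<close> to \<open>\<beta> \<circ> (\<nu> * \<nu>') \<circ> inv \<alpha>\<close>.\<close>

section \<open>Shuffles and sorting permutations\<close>

text \<open>The permutation that sorts the first \<open>N\<close> values of \<open>u\<close>, provided they are distinct.\<close>

definition rank_perm :: "nat \<Rightarrow> (nat \<Rightarrow> real) \<Rightarrow> nat \<Rightarrow> nat" where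
  "rank_perm N u i = (if i < N then card {j. j < N \<and> u j < u i} else i)"

lemma rank_perm_less:
  assumes "i < N" "u i < u j" "j < N"
  shows "rank_perm N u i < rank_perm N u j"
proof -
  have "{l. l < N \<and> u l < u i} \<subset> {l. l < N \<and> u l < u j}"
    using assms by force
  then show ?thesis
    using assms by (simp add: rank_perm_def psubset_card_mono)
qed

lemma rank_perm_less_iff:
  assumes "i < N" "j < N"
  shows "rank_perm N u i < rank_perm N u j \<longleftrightarrow> u i < u j"
proof (cases "u i" "u j" rule: linorder_cases)
  case less
  then show ?thesis using rank_perm_less[of i N u j] assms by simp
next
  case equal
  then show ?thesis using assms by (simp add: rank_perm_def)
next
  case greater
  then show ?thesis using rank_perm_less[of j N u i] assms by simp
qed

text \<open>Distinct values have distinct ranks, and a rank counts a proper subset of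
  \<open>{..<N}\<close> because \<open>i\<close> is not below itself. An injective self-map of a
  finite set is onto.\<close>

lemma rank_perm_permutes:
  assumes "inj_on u {..<N}"
  shows "rank_perm N u permutes {..<N}"
proof (rule bij_imp_permutes)
  have inj: "inj_on (rank_perm N u) {..<N}"
  proof (rule inj_onI)
    fix i j assume ij: "i \<in> {..<N}" "j \<in> {..<N}" "rank_perm N u i = rank_perm N u j"
    then have "u i = u j"
      using rank_perm_less_iff[of i N j u] rank_perm_less_iff[of j N i u] by simp
    with ij show "i = j" using assms by (auto dest: inj_onD)
  qed
  have "rank_perm N u ` {..<N} \<subseteq> {..<N}"
  proof (clarsimp simp: rank_perm_def)
    fix i assume "i < N"
    then have "{j. j < N \<and> u j < u i} \<subset> {..<N}" by auto
    then show "card {j. j < N \<and> u j < u i} < N"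
      by (metis card_lessThan finite_lessThan psubset_card_mono)
  qed
  with inj show "bij_betw (rank_perm N u) {..<N} {..<N}"
    by (simp add: bij_betw_def endo_inj_surj)
qed (simp add: rank_perm_def)

text \<open>A permutation carries the indices \<open>j\<close> with
  \<open>\<rho> j < \<rho> i\<close> bijectively onto \<open>{..<\<rho> i}\<close>, so
  \<open>\<rho> i\<close> is the number of such indices. If \<open>\<rho>\<close> orders indices as
  \<open>u\<close> does, that number is the rank of \<open>u i\<close>.\<close>

lemma permutes_eq_rank_perm:
  assumes \<rho>: "\<rho> permutes {..<N}" and less: "\<And>i j. i < N \<Longrightarrow> j < N \<Longrightarrow> \<rho> i < \<rho> j \<longleftrightarrow> u i < u j"
  shows "\<rho> = rank_perm N u"
proof
  fix i
  show "\<rho> i = rank_perm N u i"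
  proof (cases "i < N")
    case True
    then have lt: "\<rho> i < N" using permutes_in_image[OF \<rho>] by simp
    have "{..<\<rho> i} = \<rho> ` {j. j < N \<and> \<rho> j < \<rho> i}"
    proof (intro equalityI subsetI)
      fix l assume l: "l \<in> {..<\<rho> i}"
      have "inv \<rho> l < N"
        using l lt permutes_in_image[OF permutes_inv[OF \<rho>]] by (metis lessThan_iff order_less_trans)
      then show "l \<in> \<rho> ` {j. j < N \<and> \<rho> j < \<rho> i}"
        using l permutes_inverses(1)[OF \<rho>] by (intro image_eqI[of _ _ "inv \<rho> l"]) auto
    qed auto
    also have "card \<dots> = card {j. j < N \<and> \<rho> j < \<rho> i}"
      by (intro card_image inj_on_subset[OF permutes_inj[OF \<rho>]]) auto
    also have "{j. j < N \<and> \<rho> j < \<rho> i} = {j. j < N \<and> u j < u i}"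
      using less True by auto
    finally show ?thesis using True by (simp add: rank_perm_def)
  next
    case False
    then show ?thesis using permutes_not_in[OF \<rho>] by (simp add: rank_perm_def)
  qed
qed

text \<open>The sequence \<open>u \<circ> inv \<rho>\<close> has \<open>u i\<close> at position
  \<open>\<rho> i\<close>, so it increases exactly if \<open>\<rho>\<close> follows the order of the
  values. With \<open>rank_perm_permutes\<close> this gives existence and uniqueness of the sorting
  permutation.\<close>

lemma mono_on_comp_inv_iff:
  assumes \<rho>: "\<rho> permutes {..<N}" and u: "inj_on u {..<N}"
  shows "mono_on {..<N} (u \<circ> inv \<rho>) \<longleftrightarrow> \<rho> = rank_perm N u"
proof
  assume mono: "mono_on {..<N} (u \<circ> inv \<rho>)"
  have le: "u i \<le> u j" if "i < N" "j < N" "\<rho> i \<le> \<rho> j" for i j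
    using mono_onD[OF mono, of "\<rho> i" "\<rho> j"] that permutes_in_image[OF \<rho>] permutes_inverses(2)[OF \<rho>]
    by simp
  show "\<rho> = rank_perm N u"
  proof (rule permutes_eq_rank_perm[OF \<rho>])
    fix i j assume ij: "i < N" "j < N"
    \<comment> \<open>Distinctness turns the weak inequalities of \<open>le\<close> into strict ones
      in both directions.\<close>
    have "u i = u j \<longleftrightarrow> i = j" using u ij by (auto simp: inj_on_def)
    then show "\<rho> i < \<rho> j \<longleftrightarrow> u i < u j"
      using le[of i j] le[of j i] ij by (metis leD less_le linorder_not_le)
  qed
next
  assume eq: "\<rho> = rank_perm N u"
  show "mono_on {..<N} (u \<circ> inv \<rho>)"
  proof (rule mono_onI)
    fix i j assume ij: "i \<in> {..<N}" "j \<in> {..<N}" "i \<le> j"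
    have "inv \<rho> i < N" "inv \<rho> j < N"
      using ij permutes_in_image[OF permutes_inv[OF \<rho>]] by auto
    moreover have "rank_perm N u (inv \<rho> i) = i" "rank_perm N u (inv \<rho> j) = j"
      using permutes_inverses(1)[OF \<rho>] eq by simp_all
    ultimately show "(u \<circ> inv \<rho>) i \<le> (u \<circ> inv \<rho>) j"
      using rank_perm_less_iff[of "inv \<rho> j" N "inv \<rho> i" u] ij by auto
  qed
qed

lemma finite_sh [simp]: "finite (sh n k)"
  by (rule finite_subset[OF _ finite_permutations[of "{..<n + k}"]]) (auto simp: sh_def)

text \<open>This splits the domain in one coordinate. Only \<open>rank_perm\<close> can give a
  nonzero term, so the sum is 1 or 0 according to whether that permutation is a shuffle, that is,
  whether \<open>u\<close> increases on each block. As an identity of indicators it can be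
  substituted into an integrand.\<close>

lemma sum_sh_mono_on:
  fixes u :: "nat \<Rightarrow> real"
  assumes u: "inj_on u {..<n + k}"
  shows "(\<Sum>\<rho>\<in>sh n k. of_bool (mono_on {..<n + k} (u \<circ> inv \<rho>))) =
    (of_bool (mono_on {..<n} u \<and> mono_on {n..<n + k} u) :: real)"
proof -
  let ?r = "rank_perm (n + k) u"
  have r: "?r permutes {..<n + k}" using u by (rule rank_perm_permutes)
  \<comment> \<open>Shuffles are strictly monotone on blocks while the simplex has weak
    inequalities; without ties among the values of \<open>u\<close> the two agree.\<close>
  have block: "strict_mono_on A ?r \<longleftrightarrow> mono_on A u" if A: "A \<subseteq> {..<n + k}" for A
  proof -
    have "u i \<le> u j \<longleftrightarrow> u i < u j" if "i \<in> A" "j \<in> A" "i < j" for i j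
      using u A that by (auto simp: inj_on_def less_le)
    moreover have "?r i < ?r j \<longleftrightarrow> u i < u j" if "i \<in> A" "j \<in> A" for i j
      using A that by (auto intro!: rank_perm_less_iff)
    ultimately show ?thesis
      by (simp add: strict_mono_on_def mono_on_def) (metis le_less order_refl)
  qed
  have "(\<Sum>\<rho>\<in>sh n k. of_bool (mono_on {..<n + k} (u \<circ> inv \<rho>))) =
      (\<Sum>\<rho>\<in>sh n k. if \<rho> = ?r then 1 else (0 :: real))"
    using mono_on_comp_inv_iff[OF _ u] by (intro sum.cong) (auto simp: sh_def)
  also have "\<dots> = of_bool (?r \<in> sh n k)"
    by simp
  also have "?r \<in> sh n k \<longleftrightarrow> mono_on {..<n} u \<and> mono_on {n..<n + k} u"
    using r block[of "{..<n}"] block[of "{n..<n + k}"] by (force simp: sh_def)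
  finally show ?thesis .
qed

section \<open>Concatenated permutations and sums over \<open>Sh\<close>\<close>

lemma perm_concat_permutes:
  assumes "\<sigma> permutes {..<n}" "\<tau> permutes {..<k}"
  shows "perm_concat n \<sigma> \<tau> permutes {..<n + k}"
proof (rule bij_imp_permutes)
  have \<sigma>: "\<sigma> i < n \<longleftrightarrow> i < n" and \<tau>: "\<tau> i < k \<longleftrightarrow> i < k" for i
    using permutes_in_image assms by (metis lessThan_iff)+
  have "inj_on (perm_concat n \<sigma> \<tau>) {..<n + k}"
  proof (rule inj_onI)
    fix i j assume ij: "perm_concat n \<sigma> \<tau> i = perm_concat n \<sigma> \<tau> j"
    show "i = j"
      using ij \<sigma>[of i] \<sigma>[of j] injD[OF permutes_inj[OF assms(1)], of i j]
        injD[OF permutes_inj[OF assms(2)], of "i - n" "j - n"]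
      by (auto simp: perm_concat_def split: if_splits)
  qed
  moreover have "perm_concat n \<sigma> \<tau> i < n + k" if "i < n + k" for i
    using \<sigma>[of i] \<tau>[of "i - n"] that by (auto simp: perm_concat_def)
  ultimately show "bij_betw (perm_concat n \<sigma> \<tau>) {..<n + k} {..<n + k}"
    unfolding bij_betw_def by (metis endo_inj_surj finite_lessThan image_subsetI lessThan_iff)
  \<comment> \<open>Beyond both blocks \<open>i - n\<close> lies outside \<open>{..<k}\<close>, so
    \<open>\<tau>\<close> fixes it and adding \<open>n\<close> returns \<open>i\<close>.\<close>
  show "perm_concat n \<sigma> \<tau> i = i" if "i \<notin> {..<n + k}" for i
    using that permutes_not_in[OF assms(2), of "i - n"] by (auto simp: perm_concat_def)
qed

text \<open>Both blocks are preserved, so inversion is blockwise. The inverses sit inside because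
  the theorem takes \<open>\<mu>\<close> from \<open>Sh\<close> of the inverse permutations.\<close>

lemma inv_perm_concat:
  assumes "\<sigma> permutes {..<n}" "\<tau> permutes {..<k}"
  shows "inv (perm_concat n (inv \<sigma>) (inv \<tau>)) = perm_concat n \<sigma> \<tau>"
proof (rule inv_unique_comp)
  have "\<sigma> i < n \<longleftrightarrow> i < n" "inv \<sigma> i < n \<longleftrightarrow> i < n" for i
    using permutes_in_image[OF assms(1)] permutes_in_image[OF permutes_inv[OF assms(1)]]
    by (metis lessThan_iff)+
  then show "perm_concat n (inv \<sigma>) (inv \<tau>) \<circ> perm_concat n \<sigma> \<tau> = id"
    "perm_concat n \<sigma> \<tau> \<circ> perm_concat n (inv \<sigma>) (inv \<tau>) = id"
    using permutes_inverses[OF assms(1)] permutes_inverses[OF assms(2)]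
    by (auto simp: perm_concat_def fun_eq_iff)
qed

lemma perm_concat_id [simp]: "perm_concat n id id = id"
  by (auto simp: perm_concat_def fun_eq_iff)

text \<open>\<open>Sh\<close> is a set, so no term may be lost by two shuffles giving the same
  element. They cannot: the concatenated permutation cancels on the left, and a permutation is
  determined by its inverse.\<close>

lemma sum_Sh:
  assumes \<sigma>: "\<sigma> permutes {..<n}" and \<tau>: "\<tau> permutes {..<k}"
  shows "(\<Sum>\<mu>\<in>Sh n k \<sigma> \<tau>. f \<mu>) = (\<Sum>\<rho>\<in>sh n k. f (perm_concat n \<sigma> \<tau> \<circ> inv \<rho>))"
proof -
  have "inj_on (\<lambda>\<rho>. perm_concat n \<sigma> \<tau> \<circ> inv \<rho>) (sh n k)"
  proof (rule inj_onI)
    fix \<rho> \<rho>' assume *: "\<rho> \<in> sh n k" "\<rho>' \<in> sh n k"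
      "perm_concat n \<sigma> \<tau> \<circ> inv \<rho> = perm_concat n \<sigma> \<tau> \<circ> inv \<rho>'"
    then have "inv \<rho> = inv \<rho>'"
      using injD[OF permutes_inj[OF perm_concat_permutes[OF \<sigma> \<tau>]]] by (auto simp: fun_eq_iff)
    moreover have "inv (inv \<rho>) = \<rho>" "inv (inv \<rho>') = \<rho>'"
      using * by (auto simp: sh_def intro!: inv_inv_eq permutes_bij)
    ultimately show "\<rho> = \<rho>'" by metis
  qed
  then show ?thesis
    unfolding Sh_def by (simp add: sum.reindex)
qed


section \<open>Measure-preserving rearrangements of product measures\<close>

text \<open>After substituting \<open>j = p i\<close>, the factor with index \<open>j\<close> sees
  only coordinate \<open>j\<close>, the form in which an integral over a product measure
  factors.\<close>

lemma prod_permute_shift: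
  assumes "p permutes I"
  shows "(\<Prod>i\<in>I. f i (p i)) = (\<Prod>j\<in>I. f (inv p j) j)"
  using prod.reindex_bij_betw[OF permutes_imp_bij[OF assms], of "\<lambda>j. f (inv p j) j"]
  by (simp add: permutes_inverses[OF assms])

text \<open>The two components may be permuted independently; the preimage of a box under the map is then
  not a product set, so its measure is computed by integrating a product of indicator functions
  first over \<open>y\<close> and then over \<open>x\<close>.\<close>

lemma distr_pair_PiM_zip:
  assumes A: "sigma_finite_measure A" and B: "sigma_finite_measure B"
    and I: "finite I" and a: "a permutes I" and b: "b permutes I"
  shows "distr (PiM I (\<lambda>_. A) \<Otimes>\<^sub>M PiM I (\<lambda>_. B)) (PiM I (\<lambda>_. A \<Otimes>\<^sub>M B))
      (\<lambda>(x, y). \<lambda>i\<in>I. (x (a i), y (b i))) = PiM I (\<lambda>_. A \<Otimes>\<^sub>M B)"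
    (is "distr ?P ?Q ?W = _")
proof -
  interpret A: sigma_finite_measure A by fact
  interpret B: sigma_finite_measure B by fact
  interpret AB: pair_sigma_finite A B ..
  interpret PA: product_sigma_finite "\<lambda>_. A" by standard
  interpret PB: product_sigma_finite "\<lambda>_. B" by standard
  interpret PAB: product_sigma_finite "\<lambda>_. A \<Otimes>\<^sub>M B" ..
  interpret FA: finite_product_sigma_finite "\<lambda>_. A" I by standard fact
  interpret FB: finite_product_sigma_finite "\<lambda>_. B" I by standard fact
  have in_I: "a i \<in> I" "b i \<in> I" if "i \<in> I" for i
    using that permutes_in_image a b by metis+
  have W: "?W \<in> measurable ?P ?Q"
    using in_I by measurable
  show ?thesis
  proof (rule PAB.PiM_eqI[OF I])
    \<comment> \<open>Agreement on boxes suffices. The sides \<open>C i\<close> are arbitrary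
      measurable sets of pairs and may couple the two components.\<close>
    fix C assume C[measurable]: "\<And>i. i \<in> I \<Longrightarrow> C i \<in> sets (A \<Otimes>\<^sub>M B)"
    have PiE_in: "Pi\<^sub>E I C \<in> sets ?Q"
      using I C by (intro sets_PiM_I_finite) auto
    let ?c = "b \<circ> inv a"
    have c: "?c permutes I" using a b by (intro permutes_compose permutes_inv)
    let ?h = "\<lambda>i x. \<integral>\<^sup>+ y. indicator (C i) (x, y) \<partial>B"
    have "emeasure (distr ?P ?Q ?W) (Pi\<^sub>E I C) = (\<integral>\<^sup>+ q. indicator (Pi\<^sub>E I C) q \<partial>distr ?P ?Q ?W)"
      using PiE_in by simp
    also have "\<dots> = (\<integral>\<^sup>+ p. indicator (Pi\<^sub>E I C) (?W p) \<partial>?P)"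
      using PiE_in by (intro nn_integral_distr W) simp
    also have "\<dots> = (\<integral>\<^sup>+ p. (\<Prod>i\<in>I. indicator (C i) (fst p (a i), snd p (b i))) \<partial>?P)"
    proof (rule nn_integral_cong)
      fix p
      show "indicator (Pi\<^sub>E I C) (?W p) =
          (\<Prod>i\<in>I. indicator (C i) (fst p (a i), snd p (b i)) :: ennreal)"
        using I by (cases p) (auto simp: indicator_def PiE_iff prod_eq_1_iff intro!: prod_zero)
    qed
    also have "\<dots> = (\<integral>\<^sup>+ x. \<integral>\<^sup>+ y. (\<Prod>i\<in>I. indicator (C i) (x (a i), y (b i))) \<partial>PiM I (\<lambda>_. B) \<partial>PiM I (\<lambda>_. A))"
      using in_I by (subst FB.nn_integral_fst[symmetric]) (auto intro!: borel_measurable_prod_ennreal)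
    also have "\<dots> = (\<integral>\<^sup>+ x. (\<Prod>i\<in>I. ?h i (x (a i))) \<partial>PiM I (\<lambda>_. A))"
    proof (rule nn_integral_cong)
      fix x assume x: "x \<in> space (PiM I (\<lambda>_. A))"
      have xa: "x (a i) \<in> space A" if "i \<in> I" for i
        using x in_I that by (auto simp: space_PiM)
      have "(\<integral>\<^sup>+ y. (\<Prod>i\<in>I. indicator (C i) (x (a i), y (b i))) \<partial>PiM I (\<lambda>_. B)) =
          (\<integral>\<^sup>+ y. (\<Prod>j\<in>I. indicator (C (inv b j)) (x (a (inv b j)), y j)) \<partial>PiM I (\<lambda>_. B))"
        by (intro nn_integral_cong prod_permute_shift[OF b])
      also have "\<dots> = (\<Prod>j\<in>I. \<integral>\<^sup>+ y. indicator (C (inv b j)) (x (a (inv b j)), y) \<partial>B)"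
        using I xa permutes_in_image[OF permutes_inv[OF b]]
        by (subst PB.product_nn_integral_prod) auto
      \<comment> \<open>Back at the index \<open>i\<close>, each factor is a function of
        \<open>x (a i)\<close> alone, so the integral over \<open>x\<close> can be treated in the
        same way.\<close>
      also have "\<dots> = (\<Prod>i\<in>I. ?h i (x (a i)))"
        by (rule prod_permute_shift[OF b, symmetric])
      finally show "(\<integral>\<^sup>+ y. (\<Prod>i\<in>I. indicator (C i) (x (a i), y (b i))) \<partial>PiM I (\<lambda>_. B)) = \<dots>" .
    qed
    also have "\<dots> = (\<integral>\<^sup>+ x. (\<Prod>j\<in>I. ?h (inv a j) (x j)) \<partial>PiM I (\<lambda>_. A))"
      by (intro nn_integral_cong prod_permute_shift[OF a])
    also have "\<dots> = (\<Prod>j\<in>I. \<integral>\<^sup>+ x. ?h (inv a j) x \<partial>A)"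
      using I permutes_in_image[OF permutes_inv[OF a]]
      by (subst PA.product_nn_integral_prod) auto
    also have "\<dots> = (\<Prod>i\<in>I. \<integral>\<^sup>+ x. ?h i x \<partial>A)"
      by (rule prod_permute_shift[OF a, symmetric])
    also have "\<dots> = (\<Prod>i\<in>I. emeasure (A \<Otimes>\<^sub>M B) (C i))"
      by (intro prod.cong) (simp_all add: B.emeasure_pair_measure)
    finally show "emeasure (distr ?P ?Q ?W) (Pi\<^sub>E I C) = (\<Prod>i\<in>I. emeasure (A \<Otimes>\<^sub>M B) (C i))" .
  qed simp
qed

text \<open>The measure \<open>?Q\<close> is itself the image of the pair of product measures under
  zipping with identities. Following this zip by the rearrangement gives the zip with
  \<open>a\<close> and \<open>b\<close>, whose image is \<open>?Q\<close> again.\<close>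

lemma distr_PiM_permute_components:
  assumes A: "sigma_finite_measure A" and B: "sigma_finite_measure B"
    and I: "finite I" and a: "a permutes I" and b: "b permutes I"
  shows "distr (PiM I (\<lambda>_. A \<Otimes>\<^sub>M B)) (PiM I (\<lambda>_. A \<Otimes>\<^sub>M B))
      (\<lambda>x. \<lambda>i\<in>I. (fst (x (a i)), snd (x (b i)))) = PiM I (\<lambda>_. A \<Otimes>\<^sub>M B)"
    (is "distr ?Q ?Q ?f = _")
proof -
  let ?P = "PiM I (\<lambda>_. A) \<Otimes>\<^sub>M PiM I (\<lambda>_. B)"
  let ?W = "\<lambda>a b (x, y). \<lambda>i\<in>I. (x (a i), y (b i))"
  have in_I: "a i \<in> I" "b i \<in> I" if "i \<in> I" for i
    using that permutes_in_image a b by metis+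
  have f: "?f \<in> measurable ?Q ?Q"
    using in_I by measurable
  have W: "?W id id \<in> measurable ?P ?Q" by measurable
  have "distr ?Q ?Q ?f = distr (distr ?P ?Q (?W id id)) ?Q ?f"
    by (subst distr_pair_PiM_zip[OF A B I permutes_id permutes_id]) simp
  also have "\<dots> = distr ?P ?Q (?f \<circ> ?W id id)"
    by (rule distr_distr[OF f W])
  also have "?f \<circ> ?W id id = ?W a b"
    using in_I by (auto simp: fun_eq_iff)
  also have "distr ?P ?Q (?W a b) = ?Q"
    by (rule distr_pair_PiM_zip[OF A B I a b])
  finally show ?thesis .
qed

section \<open>Concatenation of two families of points\<close>

lemma prod_lessThan_add:
  fixes f :: "nat \<Rightarrow> 'a::comm_monoid_mult"
  shows "(\<Prod>i<n + k. f i) = (\<Prod>i<n. f i) * (\<Prod>j<k. f (n + j))"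
  by (induction k) (simp_all add: mult.assoc)

lemma measurable_append:
  fixes n k :: nat
  shows "(\<lambda>(x, y). \<lambda>i\<in>{..<n + k}. if i < n then x i else y (i - n))
    \<in> measurable (PiM {..<n} (\<lambda>_. M) \<Otimes>\<^sub>M PiM {..<k} (\<lambda>_. M)) (PiM {..<n + k} (\<lambda>_. M))"
    (is "_ \<in> measurable ?P _")
  unfolding case_prod_beta
proof (rule measurable_restrict)
  fix i assume "i \<in> {..<n + k}"
  then show "(\<lambda>p. if i < n then fst p i else snd p (i - n)) \<in> measurable ?P M"
    by (cases "i < n") (auto intro!: measurable_component_singleton
        measurable_compose[OF measurable_fst] measurable_compose[OF measurable_snd])
qed

text \<open>A box pulls back under concatenation to a product of two boxes, so the measures agree on
  boxes. This turns an integral over a pair of families into one over \<open>n + k\<close>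
  points.\<close>

lemma distr_PiM_append:
  fixes n k :: nat
  assumes M: "sigma_finite_measure M"
  shows "distr (PiM {..<n} (\<lambda>_. M) \<Otimes>\<^sub>M PiM {..<k} (\<lambda>_. M)) (PiM {..<n + k} (\<lambda>_. M))
      (\<lambda>(x, y). \<lambda>i\<in>{..<n + k}. if i < n then x i else y (i - n)) = PiM {..<n + k} (\<lambda>_. M)"
    (is "distr ?P ?Q ?c = _")
proof -
  interpret M: sigma_finite_measure M by fact
  interpret PM: product_sigma_finite "\<lambda>_. M" by standard
  interpret Fn: finite_product_sigma_finite "\<lambda>_. M" "{..<n}" by standard (rule finite_lessThan)
  interpret Fk: finite_product_sigma_finite "\<lambda>_. M" "{..<k}" by standard (rule finite_lessThan)
  have c: "?c \<in> measurable ?P ?Q" by (rule measurable_append)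
  show ?thesis
  proof (rule PM.PiM_eqI)
    fix C assume C: "\<And>i. i \<in> {..<n + k} \<Longrightarrow> C i \<in> sets M"
    have "emeasure (distr ?P ?Q ?c) (Pi\<^sub>E {..<n + k} C) = emeasure ?P (?c -` Pi\<^sub>E {..<n + k} C \<inter> space ?P)"
      using C by (intro emeasure_distr c sets_PiM_I_finite) auto
    also have "?c -` Pi\<^sub>E {..<n + k} C \<inter> space ?P = Pi\<^sub>E {..<n} C \<times> Pi\<^sub>E {..<k} (\<lambda>j. C (n + j))"
      (is "?L = ?R")
    proof (intro set_eqI iffI)
      fix p assume p: "p \<in> ?L"
      obtain x y where [simp]: "p = (x, y)" by (cases p)
      have *: "(if i < n then x i else y (i - n)) \<in> C i" if "i < n + k" for i
        using p that by (auto simp: PiE_iff)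
      have "x i \<in> C i" if "i < n" for i using *[of i] that by simp
      moreover have "y i \<in> C (n + i)" if "i < k" for i using *[of "n + i"] that by simp
      ultimately show "p \<in> ?R"
        using p by (auto simp: space_pair_measure space_PiM PiE_iff)
    next
      fix p assume p: "p \<in> ?R"
      obtain x y where [simp]: "p = (x, y)" by (cases p)
      have "(if i < n then x i else y (i - n)) \<in> C i" if "i < n + k" for i
      proof (cases "i < n")
        case False
        then have "i - n \<in> {..<k}" using that by auto
        moreover have "y \<in> Pi\<^sub>E {..<k} (\<lambda>j. C (n + j))" using p by simp
        ultimately have "y (i - n) \<in> C (n + (i - n))" by (rule PiE_mem[rotated])
        then show ?thesis using False by simp
      qed (use p in auto)
      then have "?c p \<in> Pi\<^sub>E {..<n + k} C"
        by simp
      moreover have "p \<in> space ?P"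
      proof -
        have C_space: "C i \<subseteq> space M" if "i < n + k" for i
          using C that by (intro sets.sets_into_space) simp
        have "Pi\<^sub>E {..<n} C \<subseteq> Pi\<^sub>E {..<n} (\<lambda>_. space M)"
          using C_space by (intro PiE_mono) auto
        moreover have "Pi\<^sub>E {..<k} (\<lambda>j. C (n + j)) \<subseteq> Pi\<^sub>E {..<k} (\<lambda>_. space M)"
          using C_space by (intro PiE_mono) auto
        ultimately show ?thesis
          using p by (auto simp: space_pair_measure space_PiM)
      qed
      ultimately show "p \<in> ?L"
        by simp
    qed
    also have "emeasure ?P \<dots> = (\<Prod>i<n. emeasure M (C i)) * (\<Prod>j<k. emeasure M (C (n + j)))"
      using C PM.emeasure_PiM[of "{..<n}" C] PM.emeasure_PiM[of "{..<k}" "\<lambda>j. C (n + j)"]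
      by (simp add: Fk.emeasure_pair_measure_Times sets_PiM_I_finite)
    also have "\<dots> = (\<Prod>i<n + k. emeasure M (C i))"
      by (rule prod_lessThan_add[symmetric])
    finally show "emeasure (distr ?P ?Q ?c) (Pi\<^sub>E {..<n + k} C) = (\<Prod>i<n + k. emeasure M (C i))" .
  qed simp_all
qed

text \<open>For a pair \<open>i \<noteq> j\<close>, integrating over coordinate \<open>i\<close>
  with the others fixed measures a level set of \<open>g\<close>, which is null; there are finitely
  many pairs.\<close>

lemma AE_PiM_inj_on:
  fixes g :: "'a \<Rightarrow> real"
  assumes M: "sigma_finite_measure M" and g[measurable]: "g \<in> borel_measurable M"
    and null: "\<And>c. emeasure M {x \<in> space M. g x = c} = 0" and I: "finite I"
  shows "AE x in PiM I (\<lambda>_. M). inj_on (\<lambda>i. g (x i)) I"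
proof -
  interpret M: sigma_finite_measure M by fact
  interpret PM: product_sigma_finite "\<lambda>_. M" by standard
  have "AE x in PiM I (\<lambda>_. M). g (x i) \<noteq> g (x j)" if ij: "i \<in> I" "j \<in> I" "i \<noteq> j" for i j
  proof -
    \<comment> \<open>Splitting off \<open>i\<close> leaves \<open>j\<close> among the remaining
      coordinates, so \<open>g (x j)\<close> is constant in the inner integral.\<close>
    define J where "J = I - {i}"
    have J: "I = insert i J" "finite J" "i \<notin> J" "j \<in> J" using ij I by (auto simp: J_def)
    have component: "(\<lambda>x. g (x l)) \<in> borel_measurable (PiM I (\<lambda>_. M))" if "l \<in> I" for l
      by (rule measurable_compose[OF measurable_component_singleton[OF that] g])
    have S: "{x \<in> space (PiM I (\<lambda>_. M)). \<not> g (x i) \<noteq> g (x j)} \<in> sets (PiM I (\<lambda>_. M))" (is "?S \<in> _")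
      using borel_measurable_eq[OF component[OF ij(1)] component[OF ij(2)]] by simp
    have "emeasure (PiM I (\<lambda>_. M)) ?S = (\<integral>\<^sup>+ x. indicator ?S x \<partial>PiM (insert i J) (\<lambda>_. M))"
      using S J(1) by simp
    also have "\<dots> = (\<integral>\<^sup>+ x. \<integral>\<^sup>+ y. indicator ?S (x(i := y)) \<partial>M \<partial>PiM J (\<lambda>_. M))"
      using S J by (intro PM.product_nn_integral_insert) auto
    also have "\<dots> = (\<integral>\<^sup>+ x. 0 \<partial>PiM J (\<lambda>_. M))"
    proof (rule nn_integral_cong)
      fix x assume x: "x \<in> space (PiM J (\<lambda>_. M))"
      have "(\<integral>\<^sup>+ y. indicator ?S (x(i := y)) \<partial>M) = (\<integral>\<^sup>+ y. indicator {y \<in> space M. g y = g (x j)} y \<partial>M)"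
        using x J by (intro nn_integral_cong) (auto simp: indicator_def space_PiM PiE_iff extensional_def)
      also have "\<dots> = 0" using null by (subst nn_integral_indicator) auto
      finally show "(\<integral>\<^sup>+ y. indicator ?S (x(i := y)) \<partial>M) = 0" .
    qed
    finally have "emeasure (PiM I (\<lambda>_. M)) ?S = 0" by simp
    then show ?thesis using S by (subst AE_iff_null) auto
  qed
  then have "AE x in PiM I (\<lambda>_. M). \<forall>i\<in>I. \<forall>j\<in>I. i \<noteq> j \<longrightarrow> g (x i) \<noteq> g (x j)"
    using I by (auto simp: AE_finite_all)
  then show ?thesis
    by eventually_elim (auto simp: inj_on_def)
qed


section \<open>Integrals over products of simplices\<close>

text \<open>The range restriction in \<open>Delta\<close> is absorbed into \<open>h\<close>, which is taken to vanish outside the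
  rectangle \<open>[s,t]\<close>.\<close>

definition simplex_integrand ::
    "nat \<Rightarrow> (nat \<Rightarrow> real \<times> real \<Rightarrow> real) \<Rightarrow> (nat \<Rightarrow> nat) \<Rightarrow> (nat \<Rightarrow> real \<times> real) \<Rightarrow> real" where
  "simplex_integrand n h \<nu> x =
     of_bool (mono_on {..<n} (\<lambda>i. fst (x i))) * of_bool (mono_on {..<n} (\<lambda>i. snd (x i))) *
     (\<Prod>i<n. h i (fst (x i), snd (x (\<nu> i))))"

abbreviation PiR2 :: "nat \<Rightarrow> (nat \<Rightarrow> real \<times> real) measure" where
  "PiR2 n \<equiv> PiM {..<n} (\<lambda>_. lborel)"

definition simplex_integral ::
    "nat \<Rightarrow> (nat \<Rightarrow> real \<times> real \<Rightarrow> real) \<Rightarrow> (nat \<Rightarrow> nat) \<Rightarrow> real" where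
  "simplex_integral n h \<nu> = (\<integral>x. simplex_integrand n h \<nu> x \<partial>PiR2 n)"

section \<open>Measurability, integrability and Fubini\<close>

lemma borel_measurable_PiM_component:
  assumes "g \<in> borel_measurable M" "i \<in> I"
  shows "(\<lambda>x. g (x i)) \<in> borel_measurable (PiM I (\<lambda>_. M))"
  by (rule measurable_compose[OF measurable_component_singleton[OF assms(2)] assms(1)])

text \<open>Monotonicity over a finite set is a finite conjunction of comparisons between
  coordinates. The inner map \<open>p\<close> covers the identity as well as
  \<open>inv \<rho>\<close>.\<close>

lemma pred_mono_on_PiM:
  fixes g :: "'a \<Rightarrow> real" and A :: "nat set"
  assumes g: "g \<in> borel_measurable M" and A: "finite A" "p ` A \<subseteq> I"
  shows "Measurable.pred (PiM I (\<lambda>_. M)) (\<lambda>x. mono_on A (\<lambda>i. g (x (p i))))"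
proof -
  have "Measurable.pred (PiM I (\<lambda>_. M)) (\<lambda>x. g (x (p i)) \<le> g (x (p j)))" if "i \<in> A" "j \<in> A" for i j
    unfolding pred_def using g A that
    by (intro borel_measurable_le borel_measurable_PiM_component) auto
  then have "Measurable.pred (PiM I (\<lambda>_. M)) (\<lambda>x. \<forall>i\<in>A. \<forall>j\<in>A. i \<le> j \<longrightarrow> g (x (p i)) \<le> g (x (p j)))"
    using A by (intro pred_intros_finite pred_intros_logic) auto
  moreover have "mono_on A f \<longleftrightarrow> (\<forall>i\<in>A. \<forall>j\<in>A. i \<le> j \<longrightarrow> f i \<le> f j)" for f :: "nat \<Rightarrow> real"
    by (auto simp: mono_on_def)
  ultimately show ?thesis by (simp only:)
qed

lemma borel_measurable_fst_lborel: "fst \<in> borel_measurable (lborel :: (real \<times> real) measure)"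
  and borel_measurable_snd_lborel: "snd \<in> borel_measurable (lborel :: (real \<times> real) measure)"
  by (simp_all add: borel_measurable_continuous_onI continuous_on_fst continuous_on_snd)

lemmas pred_mono_on_PiR2 =
  pred_mono_on_PiM[OF borel_measurable_fst_lborel] pred_mono_on_PiM[OF borel_measurable_snd_lborel]

text \<open>Integrability is asked of the product because it will be transported from the integrand
  on \<open>n + k\<close> points.\<close>

lemma integral_pair_mult:
  fixes f :: "'a \<Rightarrow> real" and g :: "'b \<Rightarrow> real"
  assumes "sigma_finite_measure M" "sigma_finite_measure N"
    and int: "integrable (M \<Otimes>\<^sub>M N) (\<lambda>(x, y). f x * g y)"
  shows "(\<integral>(x, y). f x * g y \<partial>(M \<Otimes>\<^sub>M N)) = (\<integral>x. f x \<partial>M) * (\<integral>y. g y \<partial>N)"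
proof -
  interpret M: sigma_finite_measure M by fact
  interpret N: sigma_finite_measure N by fact
  interpret MN: pair_sigma_finite M N ..
  show ?thesis using MN.integral_fst[OF int] by simp
qed

text \<open>A box constrains the two coordinates separately, and permuting the second coordinates
  does not change what is required of all of them together. This reconciles the support of the
  densities, tested at paired points, with the range in \<open>Delta\<close>, tested at the points
  \<open>x i\<close>.\<close>

lemma cross_mem_cbox_iff:
  fixes x :: "nat \<Rightarrow> real \<times> real"
  assumes \<nu>: "\<nu> permutes {..<n}"
  shows "(\<forall>i<n. (fst (x i), snd (x (\<nu> i))) \<in> cbox a b) \<longleftrightarrow> (\<forall>i<n. x i \<in> cbox a b)"
proof -
  have box: "(u, v) \<in> cbox a b \<longleftrightarrow> u \<in> {fst a..fst b} \<and> v \<in> {snd a..snd b}" for u v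
    by (cases a, cases b) (simp add: cbox_Pair_eq)
  have "(\<forall>i<n. snd (x (\<nu> i)) \<in> A) \<longleftrightarrow> (\<forall>i<n. snd (x i) \<in> A)" for A
  proof -
    have "(\<forall>i\<in>{..<n}. snd (x (\<nu> i)) \<in> A) \<longleftrightarrow> (\<forall>i\<in>\<nu> ` {..<n}. snd (x i) \<in> A)" by simp
    then show ?thesis unfolding permutes_image[OF \<nu>] by (simp only: Ball_def lessThan_iff)
  qed
  then have "(\<forall>i<n. fst (x i) \<in> {fst a..fst b} \<and> snd (x (\<nu> i)) \<in> {snd a..snd b}) \<longleftrightarrow>
      (\<forall>i<n. fst (x i) \<in> {fst a..fst b} \<and> snd (x i) \<in> {snd a..snd b})"
    by blast
  then show ?thesis
    unfolding box[symmetric] by simp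
qed

text \<open>The model is \<open>partial12 T X\<close> cut off to the rectangle, with letters as the
  indices \<open>l\<close>; a word enters as a map \<open>v\<close> from positions to
  letters.\<close>

locale bounded_densities =
  fixes h :: "'a \<Rightarrow> real \<times> real \<Rightarrow> real" and C :: real and a b :: "real \<times> real"
  assumes h_measurable [measurable]: "\<And>l. h l \<in> borel_measurable borel"
    and h_bound: "\<And>l p. \<bar>h l p\<bar> \<le> C"
    and h_support: "\<And>l p. p \<notin> cbox a b \<Longrightarrow> h l p = 0"
begin

lemma prod_measurable:
  assumes "\<nu> permutes {..<n}"
  shows "(\<lambda>x. \<Prod>i<n. h (v i) (fst (x i), snd (x (\<nu> i)))) \<in> borel_measurable (PiR2 n)"
proof (intro borel_measurable_prod)
  fix i assume "i \<in> {..<n}"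
  moreover from this have "\<nu> i \<in> {..<n}" using permutes_in_image[OF assms] by blast
  ultimately show "(\<lambda>x. h (v i) (fst (x i), snd (x (\<nu> i)))) \<in> borel_measurable (PiR2 n)"
    by (intro measurable_compose[OF borel_measurable_Pair h_measurable] borel_measurable_PiM_component
        borel_measurable_fst_lborel borel_measurable_snd_lborel)
qed

text \<open>The product is bounded by \<open>C ^ n\<close>, and some factor vanishes once a point
  leaves the box; the power of the box has finite measure.\<close>

lemma prod_integrable:
  assumes \<nu>: "\<nu> permutes {..<n}"
  shows "integrable (PiR2 n) (\<lambda>x. \<Prod>i<n. h (v i) (fst (x i), snd (x (\<nu> i))))"
proof (rule Bochner_Integration.integrable_bound)
  interpret PM: product_sigma_finite "\<lambda>_ :: nat. lborel :: (real \<times> real) measure" by standard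
  let ?B = "Pi\<^sub>E {..<n} (\<lambda>_. cbox a b)"
  have "?B \<in> sets (PiR2 n)" by (intro sets_PiM_I_finite) auto
  moreover have "emeasure (PiR2 n) ?B < \<infinity>"
    by (simp add: PM.emeasure_PiM power_less_top_ennreal
        emeasure_lborel_cbox_finite[unfolded infinity_ennreal_def])
  ultimately show "integrable (PiR2 n) (\<lambda>x. C ^ n * indicator ?B x)"
    by (intro integrable_mult_right integrable_real_indicator)
  show "AE x in PiR2 n. norm (\<Prod>i<n. h (v i) (fst (x i), snd (x (\<nu> i)))) \<le> norm (C ^ n * indicator ?B x)"
  proof (rule AE_I2)
    fix x assume x: "x \<in> space (PiR2 n)"
    have bound: "\<bar>\<Prod>i<n. h (v i) (fst (x i), snd (x (\<nu> i)))\<bar> \<le> C ^ n"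
      unfolding abs_prod using prod_mono[of "{..<n}" "\<lambda>i. \<bar>h (v i) (fst (x i), snd (x (\<nu> i)))\<bar>" "\<lambda>_. C"]
      by (simp add: h_bound)
    show "norm (\<Prod>i<n. h (v i) (fst (x i), snd (x (\<nu> i)))) \<le> norm (C ^ n * indicator ?B x)"
    proof (cases "x \<in> ?B")
      case True
      then show ?thesis using bound by simp
    next
      case False
      then have "\<not> (\<forall>i<n. x i \<in> cbox a b)"
        using x by (auto simp: space_PiM PiE_iff)
      then obtain i where "i < n" "h (v i) (fst (x i), snd (x (\<nu> i))) = 0"
        using cross_mem_cbox_iff[OF \<nu>] h_support by metis
      then have "(\<Prod>i<n. h (v i) (fst (x i), snd (x (\<nu> i)))) = 0"
        by (intro prod_zero) auto
      then show ?thesis by (simp only: norm_zero norm_ge_zero)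
    qed
  qed
qed (rule prod_measurable[OF \<nu>])

lemma mult_of_bool_prod_integrable:
  assumes "\<nu> permutes {..<n}" and "Measurable.pred (PiR2 n) P"
  shows "integrable (PiR2 n) (\<lambda>x. of_bool (P x) * (\<Prod>i<n. h (v i) (fst (x i), snd (x (\<nu> i)))))"
proof (rule Bochner_Integration.integrable_bound[OF prod_integrable[OF assms(1), of v]])
  have "(\<lambda>x. of_bool (P x) :: real) \<in> borel_measurable (PiR2 n)"
    using assms(2) by measurable
  then show "(\<lambda>x. of_bool (P x) * (\<Prod>i<n. h (v i) (fst (x i), snd (x (\<nu> i))))) \<in> borel_measurable (PiR2 n)"
    by (intro borel_measurable_times prod_measurable[OF assms(1)])
qed (auto simp: norm_mult)

text \<open>The measure-preserving map \<open>?f\<close> puts the first coordinate of point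
  \<open>inv \<alpha> i\<close> and the second coordinate of point \<open>inv \<beta> i\<close> at
  position \<open>i\<close>. In the new pairing \<open>\<beta>\<close> cancels against
  \<open>inv \<beta>\<close>, and the remaining \<open>inv \<alpha>\<close> only reindexes the
  product.\<close>

lemma simplex_integral_reindex:
  assumes \<nu>: "\<nu> permutes {..<n}" and \<alpha>: "\<alpha> permutes {..<n}" and \<beta>: "\<beta> permutes {..<n}"
  shows "simplex_integral n (h \<circ> v \<circ> inv \<alpha>) (\<beta> \<circ> \<nu> \<circ> inv \<alpha>) =
    (\<integral>x. of_bool (mono_on {..<n} ((\<lambda>i. fst (x i)) \<circ> inv \<alpha>)) *
         of_bool (mono_on {..<n} ((\<lambda>i. snd (x i)) \<circ> inv \<beta>)) *
         (\<Prod>i<n. h (v i) (fst (x i), snd (x (\<nu> i)))) \<partial>PiR2 n)"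
proof -
  let ?f = "\<lambda>x. \<lambda>i\<in>{..<n}. (fst (x (inv \<alpha> i)), snd (x (inv \<beta> i)))"
  let ?g = "simplex_integrand n (h \<circ> v \<circ> inv \<alpha>) (\<beta> \<circ> \<nu> \<circ> inv \<alpha>)"
  have perm: "\<beta> \<circ> \<nu> \<circ> inv \<alpha> permutes {..<n}"
    using \<nu> \<alpha> \<beta> by (intro permutes_compose permutes_inv)
  have in_n: "\<alpha> i < n \<longleftrightarrow> i < n" "inv \<alpha> i < n \<longleftrightarrow> i < n" "inv \<beta> i < n \<longleftrightarrow> i < n"
    "\<beta> i < n \<longleftrightarrow> i < n" "\<nu> i < n \<longleftrightarrow> i < n" for i
    using permutes_in_image[OF \<alpha>] permutes_in_image[OF \<beta>] permutes_in_image[OF \<nu>]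
      permutes_in_image[OF permutes_inv[OF \<alpha>]] permutes_in_image[OF permutes_inv[OF \<beta>]]
    by (metis lessThan_iff)+
  have f: "?f \<in> measurable (PiR2 n) (PiR2 n)"
  proof (rule measurable_restrict)
    fix i assume "i \<in> {..<n}"
    then have "inv \<alpha> i \<in> {..<n}" "inv \<beta> i \<in> {..<n}" using in_n by simp_all
    then show "(\<lambda>x. (fst (x (inv \<alpha> i)), snd (x (inv \<beta> i)))) \<in> measurable (PiR2 n) lborel"
      unfolding measurable_lborel1
      by (intro borel_measurable_Pair
          borel_measurable_PiM_component[OF borel_measurable_fst_lborel]
          borel_measurable_PiM_component[OF borel_measurable_snd_lborel])
  qed
  have id: "(\<lambda>i. i) ` {..<n} \<subseteq> {..<n}" by simp
  have g: "?g \<in> borel_measurable (PiR2 n)"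
    using borel_measurable_integrable[OF mult_of_bool_prod_integrable[OF perm
          pred_intros_logic(3)[OF pred_mono_on_PiR2[OF finite_lessThan id]], of "v \<circ> inv \<alpha>"]]
    unfolding simplex_integrand_def[abs_def] by (simp only: of_bool_conj comp_def)
  have "simplex_integral n (h \<circ> v \<circ> inv \<alpha>) (\<beta> \<circ> \<nu> \<circ> inv \<alpha>) =
      (\<integral>x. ?g x \<partial>distr (PiR2 n) (PiR2 n) ?f)"
    using distr_PiM_permute_components[where A = "lborel :: real measure" and B = "lborel :: real measure",
        OF lborel.sigma_finite_measure_axioms lborel.sigma_finite_measure_axioms
        finite_lessThan permutes_inv[OF \<alpha>] permutes_inv[OF \<beta>]]
    by (simp add: simplex_integral_def lborel_prod)
  also have "\<dots> = (\<integral>x. ?g (?f x) \<partial>PiR2 n)"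
    by (rule integral_distr[OF f g])
  also have "(\<lambda>x. ?g (?f x)) = (\<lambda>x. of_bool (mono_on {..<n} ((\<lambda>i. fst (x i)) \<circ> inv \<alpha>)) *
         of_bool (mono_on {..<n} ((\<lambda>i. snd (x i)) \<circ> inv \<beta>)) *
         (\<Prod>i<n. h (v i) (fst (x i), snd (x (\<nu> i)))))"
  proof
    fix x
    have "(\<Prod>i<n. (h \<circ> v \<circ> inv \<alpha>) i (fst (?f x i), snd (?f x ((\<beta> \<circ> \<nu> \<circ> inv \<alpha>) i)))) =
        (\<Prod>i<n. h (v (inv \<alpha> i)) (fst (x (inv \<alpha> i)), snd (x (\<nu> (inv \<alpha> i)))))"
      using in_n permutes_inverses[OF \<beta>] by (intro prod.cong) auto
    also have "\<dots> = (\<Prod>i<n. h (v i) (fst (x i), snd (x (\<nu> i))))"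
      by (rule prod.reindex_bij_betw[OF permutes_imp_bij[OF permutes_inv[OF \<alpha>]]])
    finally show "?g (?f x) = of_bool (mono_on {..<n} ((\<lambda>i. fst (x i)) \<circ> inv \<alpha>)) *
         of_bool (mono_on {..<n} ((\<lambda>i. snd (x i)) \<circ> inv \<beta>)) *
         (\<Prod>i<n. h (v i) (fst (x i), snd (x (\<nu> i))))"
      unfolding simplex_integrand_def by (simp add: mono_on_def)
  qed
  finally show ?thesis .
qed

lemma block_integrand_integrable:
  assumes "\<nu> permutes {..<n + k}"
  shows "integrable (PiR2 (n + k)) (\<lambda>x.
      of_bool (mono_on {..<n} (\<lambda>i. fst (x i)) \<and> mono_on {n..<n + k} (\<lambda>i. fst (x i))) *
      of_bool (mono_on {..<n} (\<lambda>i. snd (x i)) \<and> mono_on {n..<n + k} (\<lambda>i. snd (x i))) *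
      (\<Prod>i<n + k. h (v i) (fst (x i), snd (x (\<nu> i)))))"
proof -
  have sub: "(\<lambda>i. i) ` {..<n} \<subseteq> {..<n + k}" "(\<lambda>i. i) ` {n..<n + k} \<subseteq> {..<n + k}" by auto
  note m = pred_mono_on_PiR2[OF finite_lessThan sub(1)] pred_mono_on_PiR2[OF finite_atLeastLessThan sub(2)]
  have "Measurable.pred (PiR2 (n + k)) (\<lambda>x.
      (mono_on {..<n} (\<lambda>i. fst (x i)) \<and> mono_on {n..<n + k} (\<lambda>i. fst (x i))) \<and>
      (mono_on {..<n} (\<lambda>i. snd (x i)) \<and> mono_on {n..<n + k} (\<lambda>i. snd (x i))))"
    by (intro pred_intros_logic(3) m)
  from mult_of_bool_prod_integrable[OF assms this, of v] show ?thesis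
    by (simp only: of_bool_conj)
qed

text \<open>By Fubini and the invariance of the measure under concatenation, it suffices to compare
  integrands pointwise; the pairing \<open>perm_concat\<close> never links the two blocks, so the
  product factors. The common labelling \<open>v\<close> restricts to \<open>u\<close> on the first
  block and to a shift of \<open>u'\<close> on the second.\<close>

lemma simplex_integral_mult:
  assumes \<nu>: "\<nu> permutes {..<n}" and \<nu>': "\<nu>' permutes {..<k}"
    and v: "\<And>i. i < n \<Longrightarrow> v i = u i" "\<And>j. j < k \<Longrightarrow> v (n + j) = u' j"
  shows "simplex_integral n (h \<circ> u) \<nu> * simplex_integral k (h \<circ> u') \<nu>' =
    (\<integral>x. of_bool (mono_on {..<n} (\<lambda>i. fst (x i)) \<and> mono_on {n..<n + k} (\<lambda>i. fst (x i))) *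
         of_bool (mono_on {..<n} (\<lambda>i. snd (x i)) \<and> mono_on {n..<n + k} (\<lambda>i. snd (x i))) *
         (\<Prod>i<n + k. h (v i) (fst (x i), snd (x (perm_concat n \<nu> \<nu>' i)))) \<partial>PiR2 (n + k))"
    (is "_ = (\<integral>x. ?g x \<partial>_)")
proof -
  have sf: "sigma_finite_measure (PiR2 m)" for m
  proof -
    interpret finite_product_sigma_finite "\<lambda>_ :: nat. lborel :: (real \<times> real) measure" "{..<m}"
      by standard (rule finite_lessThan)
    show ?thesis by (rule sigma_finite_measure_axioms)
  qed
  let ?P = "PiR2 n \<Otimes>\<^sub>M PiR2 k"
  define c :: "(nat \<Rightarrow> real \<times> real) \<times> (nat \<Rightarrow> real \<times> real) \<Rightarrow> nat \<Rightarrow> real \<times> real"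
    where "c = (\<lambda>(x, y). \<lambda>i\<in>{..<n + k}. if i < n then x i else y (i - n))"
  define g where "g = ?g"
  have in_n: "\<nu> i < n \<longleftrightarrow> i < n" "\<nu>' i < k \<longleftrightarrow> i < k" for i
    using permutes_in_image[OF \<nu>] permutes_in_image[OF \<nu>'] by (metis lessThan_iff)+
  have distr: "distr ?P (PiR2 (n + k)) c = PiR2 (n + k)"
    unfolding c_def by (rule distr_PiM_append[OF lborel.sigma_finite_measure_axioms])
  have c: "c \<in> measurable ?P (PiR2 (n + k))"
    unfolding c_def by (rule measurable_append)
  have int: "integrable (PiR2 (n + k)) g"
    unfolding g_def by (rule block_integrand_integrable[OF perm_concat_permutes[OF \<nu> \<nu>']])
  have gc: "simplex_integrand n (h \<circ> u) \<nu> x * simplex_integrand k (h \<circ> u') \<nu>' y = g (c (x, y))" for x y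
  proof -
    have c_left: "c (x, y) i = x i" if "i < n" for i
      using that by (simp add: c_def)
    have c_right: "c (x, y) (n + j) = y j" if "j < k" for j
      using that by (simp add: c_def)
    have mono_left: "mono_on {..<n} (\<lambda>i. f (c (x, y) i)) \<longleftrightarrow> mono_on {..<n} (\<lambda>i. f (x i))"
      for f :: "real \<times> real \<Rightarrow> real"
      by (simp add: mono_on_def c_left)
    have mono_right: "mono_on {n..<n + k} (\<lambda>i. f (c (x, y) i)) \<longleftrightarrow> mono_on {..<k} (\<lambda>j. f (y j))"
      for f :: "real \<times> real \<Rightarrow> real"
    proof
      assume l: "mono_on {n..<n + k} (\<lambda>i. f (c (x, y) i))"
      show "mono_on {..<k} (\<lambda>j. f (y j))"
      proof (rule mono_onI)
        fix i j assume "i \<in> {..<k}" "j \<in> {..<k}" "i \<le> j"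
        then show "f (y i) \<le> f (y j)"
          using mono_onD[OF l, of "n + i" "n + j"] by (simp add: c_right)
      qed
    next
      assume r: "mono_on {..<k} (\<lambda>j. f (y j))"
      show "mono_on {n..<n + k} (\<lambda>i. f (c (x, y) i))"
      proof (rule mono_onI)
        fix i j assume "i \<in> {n..<n + k}" "j \<in> {n..<n + k}" "i \<le> j"
        then show "f (c (x, y) i) \<le> f (c (x, y) j)"
          using mono_onD[OF r, of "i - n" "j - n"] c_right[of "i - n"] c_right[of "j - n"] by auto
      qed
    qed
    have left: "h (v i) (fst (c (x, y) i), snd (c (x, y) (perm_concat n \<nu> \<nu>' i))) =
        h (u i) (fst (x i), snd (x (\<nu> i)))" if "i < n" for i
      using that in_n by (simp add: c_left v perm_concat_def)
    have right: "h (v (n + j)) (fst (c (x, y) (n + j)), snd (c (x, y) (perm_concat n \<nu> \<nu>' (n + j)))) =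
        h (u' j) (fst (y j), snd (y (\<nu>' j)))" if "j < k" for j
    proof -
      have "perm_concat n \<nu> \<nu>' (n + j) = n + \<nu>' j" by (simp add: perm_concat_def)
      then show ?thesis using that in_n by (simp only: c_right v)
    qed
    have prod: "(\<Prod>i<n + k. h (v i) (fst (c (x, y) i), snd (c (x, y) (perm_concat n \<nu> \<nu>' i)))) =
       (\<Prod>i<n. h (u i) (fst (x i), snd (x (\<nu> i)))) * (\<Prod>i<k. h (u' i) (fst (y i), snd (y (\<nu>' i))))"
      unfolding prod_lessThan_add using left right by simp
    show ?thesis
      unfolding simplex_integrand_def g_def prod mono_left mono_right of_bool_conj comp_def
      by (simp only: mult_ac)
  qed
  have gc': "(\<lambda>(x, y). simplex_integrand n (h \<circ> u) \<nu> x * simplex_integrand k (h \<circ> u') \<nu>' y) =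
      (\<lambda>p. g (c p))"
    by (auto simp: gc fun_eq_iff)
  have "simplex_integral n (h \<circ> u) \<nu> * simplex_integral k (h \<circ> u') \<nu>' =
      (\<integral>(x, y). simplex_integrand n (h \<circ> u) \<nu> x * simplex_integrand k (h \<circ> u') \<nu>' y \<partial>?P)"
    unfolding simplex_integral_def
  proof (rule integral_pair_mult[symmetric])
    show "integrable ?P (\<lambda>(x, y). simplex_integrand n (h \<circ> u) \<nu> x * simplex_integrand k (h \<circ> u') \<nu>' y)"
      unfolding gc' using int by (intro integrable_distr[OF c]) (simp only: distr)
  qed (rule sf)+
  also have "\<dots> = (\<integral>p. g (c p) \<partial>?P)"
    by (simp only: gc')
  also have "\<dots> = (\<integral>x. g x \<partial>distr ?P (PiR2 (n + k)) c)"
    using int by (intro integral_distr[symmetric, OF c]) (rule borel_measurable_integrable)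
  finally show ?thesis by (simp only: distr g_def)
qed

text \<open>In each coordinate the block indicator from \<open>simplex_integral_mult\<close> becomes
  a sum over shuffles by \<open>sum_sh_mono_on\<close>. This holds only almost everywhere, since
  ties can be sorted by several shuffles. Each term is then evaluated by
  \<open>simplex_integral_reindex\<close>.\<close>

lemma simplex_integral_shuffle:
  assumes \<nu>: "\<nu> permutes {..<n}" and \<nu>': "\<nu>' permutes {..<k}"
    and v: "\<And>i. i < n \<Longrightarrow> v i = u i" "\<And>j. j < k \<Longrightarrow> v (n + j) = u' j"
  shows "simplex_integral n (h \<circ> u) \<nu> * simplex_integral k (h \<circ> u') \<nu>' =
    (\<Sum>\<alpha>\<in>sh n k. \<Sum>\<beta>\<in>sh n k.
       simplex_integral (n + k) (h \<circ> v \<circ> inv \<alpha>) (\<beta> \<circ> perm_concat n \<nu> \<nu>' \<circ> inv \<alpha>))"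
proof -
  let ?I = "{..<n + k}"
  let ?G = "\<lambda>x. \<Prod>i<n + k. h (v i) (fst (x i), snd (x (perm_concat n \<nu> \<nu>' i)))"
  let ?m = "\<lambda>f \<rho> x. mono_on ?I ((\<lambda>i. f (x i)) \<circ> inv \<rho>)"
  note perm = perm_concat_permutes[OF \<nu> \<nu>']
  have sh: "\<rho> permutes ?I" if "\<rho> \<in> sh n k" for \<rho> using that by (simp add: sh_def)
  have m: "Measurable.pred (PiR2 (n + k)) (?m f \<rho>)"
    if "\<rho> \<in> sh n k" "f \<in> borel_measurable lborel" for \<rho> and f :: "real \<times> real \<Rightarrow> real"
  proof -
    have "inv \<rho> ` ?I \<subseteq> ?I"
      using permutes_image[OF permutes_inv[OF sh[OF that(1)]]] by simp
    from pred_mono_on_PiM[OF that(2) finite_lessThan this] show ?thesis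
      by (simp add: comp_def)
  qed
  have inj: "AE x in PiR2 (n + k). inj_on (\<lambda>i. f (x i)) ?I" if f: "f = fst \<or> f = snd" for f :: "real \<times> real \<Rightarrow> real"
  proof (rule AE_PiM_inj_on[OF lborel.sigma_finite_measure_axioms])
    show "f \<in> borel_measurable lborel"
      using f borel_measurable_fst_lborel borel_measurable_snd_lborel by metis
    fix c
    \<comment> \<open>The level sets of \<open>fst\<close> and \<open>snd\<close> are lines, which
      are null in the plane.\<close>
    have "{x \<in> space lborel. f x = c} = (if f = fst then {c} \<times> UNIV else UNIV \<times> {c})"
      using f by (auto split: if_splits)
    then show "emeasure lborel {x \<in> space lborel. f x = c} = 0"
      by (simp add: lborel.emeasure_pair_measure_Times flip: lborel_prod)
  qed simp
  have int: "integrable (PiR2 (n + k)) (\<lambda>x. of_bool (?m fst \<alpha> x) * of_bool (?m snd \<beta> x) * ?G x)"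
    if "\<alpha> \<in> sh n k" "\<beta> \<in> sh n k" for \<alpha> \<beta>
    using mult_of_bool_prod_integrable[OF perm
        pred_intros_logic(3)[OF m[OF that(1) borel_measurable_fst_lborel] m[OF that(2) borel_measurable_snd_lborel]], of v]
    by (simp only: of_bool_conj)
  have "simplex_integral n (h \<circ> u) \<nu> * simplex_integral k (h \<circ> u') \<nu>' =
    (\<integral>x. of_bool (mono_on {..<n} (\<lambda>i. fst (x i)) \<and> mono_on {n..<n + k} (\<lambda>i. fst (x i))) *
         of_bool (mono_on {..<n} (\<lambda>i. snd (x i)) \<and> mono_on {n..<n + k} (\<lambda>i. snd (x i))) * ?G x \<partial>PiR2 (n + k))"
    by (rule simplex_integral_mult[OF \<nu> \<nu>']) (simp_all add: v)
  also have "\<dots> = (\<integral>x. (\<Sum>\<alpha>\<in>sh n k. \<Sum>\<beta>\<in>sh n k. of_bool (?m fst \<alpha> x) * of_bool (?m snd \<beta> x) * ?G x) \<partial>PiR2 (n + k))"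
  proof (rule integral_cong_AE)
    show "AE x in PiR2 (n + k).
      of_bool (mono_on {..<n} (\<lambda>i. fst (x i)) \<and> mono_on {n..<n + k} (\<lambda>i. fst (x i))) *
      of_bool (mono_on {..<n} (\<lambda>i. snd (x i)) \<and> mono_on {n..<n + k} (\<lambda>i. snd (x i))) * ?G x =
      (\<Sum>\<alpha>\<in>sh n k. \<Sum>\<beta>\<in>sh n k. of_bool (?m fst \<alpha> x) * of_bool (?m snd \<beta> x) * ?G x)"
      using inj[of fst, simplified] inj[of snd, simplified]
    proof eventually_elim
      case (elim x)
      show ?case
        \<comment> \<open>The two indicators expand independently, so \<open>\<alpha>\<close> and
          \<open>\<beta>\<close> range over all pairs of shuffles.\<close>
        unfolding sum_sh_mono_on[OF elim(1), symmetric] sum_sh_mono_on[OF elim(2), symmetric]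
        unfolding sum_product by (simp only: sum_distrib_right)
    qed
    show "(\<lambda>x. \<Sum>\<alpha>\<in>sh n k. \<Sum>\<beta>\<in>sh n k. of_bool (?m fst \<alpha> x) * of_bool (?m snd \<beta> x) * ?G x)
        \<in> borel_measurable (PiR2 (n + k))"
      by (intro borel_measurable_sum borel_measurable_integrable[OF int])
  qed (rule borel_measurable_integrable[OF block_integrand_integrable[OF perm]])
  also have "\<dots> = (\<Sum>\<alpha>\<in>sh n k. \<Sum>\<beta>\<in>sh n k. \<integral>x. of_bool (?m fst \<alpha> x) * of_bool (?m snd \<beta> x) * ?G x \<partial>PiR2 (n + k))"
    using int by (simp add: Bochner_Integration.integral_sum Bochner_Integration.integrable_sum)
  also have "\<dots> = (\<Sum>\<alpha>\<in>sh n k. \<Sum>\<beta>\<in>sh n k.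
       simplex_integral (n + k) (h \<circ> v \<circ> inv \<alpha>) (\<beta> \<circ> perm_concat n \<nu> \<nu>' \<circ> inv \<alpha>))"
    using sh by (intro sum.cong refl simplex_integral_reindex[OF perm, symmetric]) auto
  finally show ?thesis .
qed

end

section \<open>From the signature to simplex integrals, and the product formula\<close>

lemma nth_permute_list:
  assumes "i < length xs"
  shows "permute_list p xs ! i = xs ! p i"
  using assms by (simp add: permute_list_def)

text \<open>The cutoff factors take over the range condition of \<open>Delta\<close>: by
  \<open>cross_mem_cbox_iff\<close> they are all 1 if every point lies in the rectangle, and
  otherwise both integrands are 0.\<close>

lemma sig2_eq_simplex_integral:
  assumes "length w = n" and \<nu>: "\<nu> permutes {..<n}"
  shows "sig2 T X s t (w, \<nu>) =
    simplex_integral n (\<lambda>i p. indicator (cbox s t) p * (partial12 T X p $ (w ! i))) \<nu>"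
  unfolding sig2_def simplex_integral_def set_lebesgue_integral_def case_prod_conv assms(1)
proof (rule Bochner_Integration.integral_cong)
  fix x assume "x \<in> space (PiR2 n)"
  \<comment> \<open>Points of the product space are \<open>undefined\<close> outside
    \<open>{..<n}\<close>, as membership in \<open>Delta\<close> demands.\<close>
  then have x: "x \<in> extensional {..<n}" by (simp add: space_PiM PiE_def)
  have box: "cbox s t = {fst s..fst t} \<times> {snd s..snd t}"
    by (cases s, cases t) (auto simp: cbox_Pair_eq)
  let ?F = "\<lambda>i. partial12 T X (fst (x i), snd (x (\<nu> i))) $ (w ! i)"
  let ?I = "\<lambda>i. indicator (cbox s t) (fst (x i), snd (x (\<nu> i))) :: real"
  show "indicator (Delta n s t) x *\<^sub>R (\<Prod>i<n. ?F i) =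
      simplex_integrand n (\<lambda>i p. indicator (cbox s t) p * (partial12 T X p $ (w ! i))) \<nu> x"
  proof (cases "\<forall>i<n. x i \<in> cbox s t")
    case True
    then have "?I i = 1" if "i < n" for i
      using that cross_mem_cbox_iff[OF \<nu>, of x s t] by simp
    then have "(\<Prod>i<n. ?I i * ?F i) = (\<Prod>i<n. ?F i)"
      by (intro prod.cong) auto
    moreover have "x \<in> Delta n s t \<longleftrightarrow>
        mono_on {..<n} (\<lambda>i. fst (x i)) \<and> mono_on {..<n} (\<lambda>i. snd (x i))"
      using True x by (auto simp: Delta_def PiE_iff box)
    ultimately show ?thesis
      by (simp add: simplex_integrand_def indicator_def)
  next
    case False
    then obtain i where i: "i < n" "?I i = 0"
      using cross_mem_cbox_iff[OF \<nu>, of x s t] by (metis indicator_simps(2))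
    have "(\<Prod>i<n. ?I i * ?F i) = 0"
      using i by (intro prod_zero) (auto intro!: bexI[of _ i])
    moreover have "x \<notin> Delta n s t"
      using False by (auto simp: Delta_def PiE_iff box)
    ultimately show ?thesis
      by (simp add: simplex_integrand_def)
  qed
qed simp

lemma simplex_integral_cong:
  assumes "\<And>i. i < n \<Longrightarrow> h i = h' i"
  shows "simplex_integral n h \<nu> = simplex_integral n h' \<nu>"
  using assms by (simp add: simplex_integral_def simplex_integrand_def)

lemma continuous_on_partial12:
  assumes "Ck_on_square 2 T X"
  shows "continuous_on (square T) (partial12 T X)"
  using assms by (simp add: numeral_2_eq_2 partial12_def)

text \<open>The rectangle is a compact part of the square, on which the mixed derivative is
  continuous; hence it is bounded there, and its extension by 0 is Borel.\<close>

lemma bounded_densities_partial12: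
  fixes X :: "real \<times> real \<Rightarrow> real ^ 'd"
  assumes X: "Ck_on_square 2 T X" and s: "s \<in> square T" and t: "t \<in> square T"
  obtains C where "bounded_densities (\<lambda>l p. indicator (cbox s t) p * (partial12 T X p $ l)) C s t"
proof -
  have sub: "cbox s t \<subseteq> square T"
    using s t by (cases s, cases t) (auto simp: cbox_Pair_eq square_def)
  have cont: "continuous_on (cbox s t) (partial12 T X)"
    using continuous_on_subset[OF continuous_on_partial12[OF X] sub] .
  then have "bounded (partial12 T X ` cbox s t)"
    by (intro compact_imp_bounded compact_continuous_image compact_cbox)
  then obtain C where C: "\<And>p. p \<in> cbox s t \<Longrightarrow> norm (partial12 T X p) \<le> C"
    unfolding bounded_iff by blast
  \<comment> \<open>The bound must also hold off the rectangle, where the density is 0;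
    \<open>C\<close> could be negative if \<open>cbox s t\<close> is empty, hence
    \<open>\<bar>C\<bar>\<close>.\<close>
  have "bounded_densities (\<lambda>l p. indicator (cbox s t) p * (partial12 T X p $ l)) \<bar>C\<bar> s t"
  proof
    fix l :: 'd and p
    show "(\<lambda>p. indicator (cbox s t) p * (partial12 T X p $ l)) \<in> borel_measurable borel"
      using borel_measurable_continuous_on_indicator[OF borel_closed[OF closed_cbox], of s t "\<lambda>p. partial12 T X p $ l"]
        continuous_on_component[OF cont, of l] by simp
    show "\<bar>indicator (cbox s t) p * (partial12 T X p $ l)\<bar> \<le> \<bar>C\<bar>"
    proof (cases "p \<in> cbox s t")
      case True
      then have "\<bar>partial12 T X p $ l\<bar> \<le> C"
        using C[of p] component_le_norm_cart[of "partial12 T X p" l] by linarith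
      then show ?thesis using True by simp
    qed simp
    show "p \<notin> cbox s t \<Longrightarrow> indicator (cbox s t) p * (partial12 T X p $ l) = 0"
      by simp
  qed
  then show ?thesis by (rule that)
qed

text \<open>The inner sum composes \<open>inv \<mu>\<close> with \<open>\<tau>\<close>, for
  \<open>\<mu>\<close> in \<open>Sh n n' (inv \<nu>) (inv \<nu>')\<close>, where the formula in
  words at the top has an element of \<open>Sh n n' \<nu> \<nu>'\<close> itself. In this form
  \<open>inv \<mu> \<circ> \<tau>\<close> is exactly the pairing \<open>\<beta> \<circ> perm_concat
  n \<nu> \<nu>' \<circ> inv \<alpha>\<close> that the change of variables produces.\<close>

theorem proposition4p30:
  fixes T :: real
    and X :: "real \<times> real \<Rightarrow> real ^ 'd"
    and s t :: "real \<times> real"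
    and n n' :: nat
    and w w' :: "'d list"
    and \<nu> \<nu>' :: "nat \<Rightarrow> nat"
  assumes "T > 0"
    and "Ck_on_square 2 T X"
    and "(w, \<nu>) \<in> ext_words n"
    and "(w', \<nu>') \<in> ext_words n'"
    and "s \<in> square T" and "t \<in> square T"
    and "fst s \<le> fst t" and "snd s \<le> snd t"
  shows "sig2 T X s t (w, \<nu>) * sig2 T X s t (w', \<nu>') =
    (\<Sum>\<tau>\<in>Sh n n' id id. \<Sum>\<mu>\<in>Sh n n' (inv \<nu>) (inv \<nu>').
       sig2 T X s t (permute_list \<tau> (w @ w'), inv \<mu> \<circ> \<tau>))"
proof -
  define h where "h = (\<lambda>l p. indicator (cbox s t) p * (partial12 T X p $ l))"
  obtain C where "bounded_densities h C s t"
    using bounded_densities_partial12[OF assms(2,5,6)] unfolding h_def by blast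
  then interpret bounded_densities h C s t .
  have w: "length w = n" "length w' = n'" and \<nu>: "\<nu> permutes {..<n}" and \<nu>': "\<nu>' permutes {..<n'}"
    using assms(3,4) by (auto simp: ext_words_def)
  note inv_perms = permutes_inv[OF \<nu>] permutes_inv[OF \<nu>']
  note perm = perm_concat_permutes[OF \<nu> \<nu>']
  have sig: "sig2 T X s t (u, \<kappa>) = simplex_integral m (h \<circ> (!) u) \<kappa>"
    if "length u = m" "\<kappa> permutes {..<m}" for u m \<kappa>
    using sig2_eq_simplex_integral[OF that] by (simp add: h_def comp_def)
  have "sig2 T X s t (w, \<nu>) * sig2 T X s t (w', \<nu>') =
      (\<Sum>\<alpha>\<in>sh n n'. \<Sum>\<beta>\<in>sh n n'.
        simplex_integral (n + n') (h \<circ> (!) (w @ w') \<circ> inv \<alpha>) (\<beta> \<circ> perm_concat n \<nu> \<nu>' \<circ> inv \<alpha>))"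
    unfolding sig[OF w(1) \<nu>] sig[OF w(2) \<nu>']
    by (rule simplex_integral_shuffle[OF \<nu> \<nu>']) (simp_all add: nth_append w)
  \<comment> \<open>Here \<open>inv \<alpha>\<close> becomes \<open>\<tau>\<close>, and
    \<open>perm_concat n (inv \<nu>) (inv \<nu>') \<circ> inv \<beta>\<close> becomes
    \<open>\<mu>\<close>.\<close>
  also have "\<dots> = (\<Sum>\<alpha>\<in>sh n n'. \<Sum>\<beta>\<in>sh n n'.
      sig2 T X s t (permute_list (inv \<alpha>) (w @ w'),
        inv (perm_concat n (inv \<nu>) (inv \<nu>') \<circ> inv \<beta>) \<circ> inv \<alpha>))"
  proof (intro sum.cong refl)
    fix \<alpha> \<beta> assume "\<alpha> \<in> sh n n'" "\<beta> \<in> sh n n'"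
    then have \<alpha>: "\<alpha> permutes {..<n + n'}" and \<beta>: "\<beta> permutes {..<n + n'}"
      by (auto simp: sh_def)
    have inv: "inv (perm_concat n (inv \<nu>) (inv \<nu>') \<circ> inv \<beta>) = \<beta> \<circ> perm_concat n \<nu> \<nu>'"
      using permutes_bij[OF perm_concat_permutes[OF inv_perms]] permutes_bij[OF permutes_inv[OF \<beta>]]
        permutes_inv_inv[OF \<beta>] inv_perm_concat[OF \<nu> \<nu>']
      by (simp add: o_inv_distrib)
    have "\<beta> \<circ> perm_concat n \<nu> \<nu>' \<circ> inv \<alpha> permutes {..<n + n'}"
      using \<alpha> \<beta> perm by (intro permutes_compose permutes_inv)
    from sig[OF _ this, of "permute_list (inv \<alpha>) (w @ w')"]
    have "sig2 T X s t (permute_list (inv \<alpha>) (w @ w'), \<beta> \<circ> perm_concat n \<nu> \<nu>' \<circ> inv \<alpha>) =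
        simplex_integral (n + n') (h \<circ> (!) (permute_list (inv \<alpha>) (w @ w')))
          (\<beta> \<circ> perm_concat n \<nu> \<nu>' \<circ> inv \<alpha>)"
      by (simp add: w)
    also have "\<dots> = simplex_integral (n + n') (h \<circ> (!) (w @ w') \<circ> inv \<alpha>)
        (\<beta> \<circ> perm_concat n \<nu> \<nu>' \<circ> inv \<alpha>)"
      \<comment> \<open>Lookup in the permuted list agrees with composition by
        \<open>inv \<alpha>\<close> at positions below the length, the only ones that the integral
        sees.\<close>
      by (rule simplex_integral_cong) (simp add: nth_permute_list w)
    finally show "simplex_integral (n + n') (h \<circ> (!) (w @ w') \<circ> inv \<alpha>)
        (\<beta> \<circ> perm_concat n \<nu> \<nu>' \<circ> inv \<alpha>) =
      sig2 T X s t (permute_list (inv \<alpha>) (w @ w'),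
        inv (perm_concat n (inv \<nu>) (inv \<nu>') \<circ> inv \<beta>) \<circ> inv \<alpha>)"
      unfolding inv by simp
  qed
  also have "\<dots> = (\<Sum>\<tau>\<in>Sh n n' id id. \<Sum>\<mu>\<in>Sh n n' (inv \<nu>) (inv \<nu>').
       sig2 T X s t (permute_list \<tau> (w @ w'), inv \<mu> \<circ> \<tau>))"
    unfolding sum_Sh[OF permutes_id permutes_id] sum_Sh[OF inv_perms] perm_concat_id id_comp ..
  finally show ?thesis .
qed

end
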